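(* Fix a round $t$. Assume that for each $i\in N$: (0) there is $M_i>0$ such that $a_i\mapsto c_i(a_i,a_{-i},\theta_i,\theta_{-i})$ is $M_i$-strongly convex on $\mathcal{A}_i$, uniformly in the other arguments; (a) $c_i$ is differentiable in $a_i$; (b) for each $j\ne i$ there are constants $L_{ij}^{c,0},L_{ij}^{c,1}\ge0$ such that for all $a_{-i},a_{-i}'\in\mathcal{A}_{-i}$ (and all $a_i,\theta_i,\theta_{-i}$), $|c_i(a_i,a_{-i}',\theta_i,\theta_{-i})-c_i(a_i,a_{-i},\theta_i,\theta_{-i})|\le\sum_{j\ne i}L_{ij}^{c,0}\|a_j'-a_j\|$ and $\|\nabla_{a_i}c_i(a_i,a_{-i}',\theta_i,\theta_{-i})-\nabla_{a_i}c_i(a_i,a_{-i},\theta_i,\theta_{-i})\|\le\sum_{j\neq i}L_{ij}^{c,1}\|a_j'-a_j\|$; (c) writing $C_f(\theta_{-i}):=c_i(a_i,f_{-i}(\theta_{-i}),\theta_i,\theta_{-i})$, there are $\kappa_i^{{\rm bp},0},\kappa_i^{{\rm bp},1}\ge0$ such that for all $f_{-i},f_{-i}'\in\mathcal{F}_{-i}$, $$\big\|\nabla_{a_i}\rho^{\rm bp}_{\nu_i^t(\cdot\mid\theta_i)}(C_f)-\nabla_{a_i}\rho^{\rm bp}_{\nu_i^t(\cdot\mid\theta_i)}(C_{f'})\big\|\le\kappa_i^{{\rm bp},1}\sup_{\theta_{-i}\in\Theta_{-i}}\|\nabla_{a_i}C_f-\nabla_{a_i}C_{f'}\|+\kappa_i^{{\rm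 bp},0}\sup_{\theta_{-i}\in\Theta_{-i}}|C_f-C_{f'}|,$$ uniformly for $a_i\in\mathcal{A}_i$ and $\theta_i\in\Theta_i$; (d) with $K_{ij}^{\rm bp}:=\kappa_i^{{\rm bp},1}L_{ij}^{c,1}+\kappa_i^{{\rm bp},0}L_{ij}^{c,0}$ for $j\ne i$, $K_{ii}^{\rm bp}:=0$, the matrix $\Gamma^{\rm bp}$ with entries $\Gamma^{\rm bp}_{ij}=K^{\rm bp}_{ij}/M_i$ has spectral radius $r(\Gamma^{\rm bp})<1$. Then, for the fixed round $t$, the BNE-BPD model has at most one equilibrium.
   Context: Game. $N=\{1,\dots,n\}$ is the set of players. For each $i\in N$ the type space $\Theta_i\subset\mathbb{R}^{d_i}$ and the action space $\mathcal{A}_i\subset\mathbb{R}^{n_i}$ are nonempty, compact and convex (standing assumption); $\Theta=\prod_j\Theta_j$, $\mathcal{A}=\prod_j\mathcal{A}_j$, and the subscript $-i$ denotes the profile or product over $j\neq i$. The loss $c_i:\mathcal{A}_i\times\mathcal{A}_{-i}\times\Theta_i\times\Theta_{-i}\to\mathbb{R}$ is continuous, hence bounded (standing assumption). $\mathcal{F}_i$ is the set of measurable functions $f_i:\Theta_i\to\mathcal{A}_i$ with the supremum norm; $\mathcal{F}=\prod_j\mathcal{F}_j$, $\mathcal{F}_{-i}=\prod_{j\ne i}\mathcal{F}_j$. $f_{-i}(\theta_{-i})=(f_j(\theta_j))_{j\neq i}$. Distributions. $\{\eta(\cdot;\zeta):\zeta\in\mathcal{Z}\}$ is a parametric family of distributions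 on $\Theta$ with densities $p(\theta;\zeta)$. At round $t$ player $i$ has a (prior/posterior) belief $\mu_i^t$ on $\mathcal{Z}$ with density $m_i^t$. The Bayesian predictive distribution $\nu_i^t$ has density $q_i^t(\theta)=\int_{\mathcal{Z}}p(\theta;\zeta)m_i^t(\zeta)\,d\zeta$, and $\nu_i^t(\cdot\mid\theta_i)$ is its conditional distribution of $\theta_{-i}$ given $\theta_i$, with density $q_i^t(\theta_{-i}\mid\theta_i)=q_i^t(\theta_i,\theta_{-i})/\int_{\Theta_{-i}}q_i^t(\theta_i,\theta_{-i})\,d\theta_{-i}$. Risk measures. A risk measure is a real functional on random losses that is monotone and cash invariant ($\rho(\xi+c)=\rho(\xi)+c$). $\rho_P$ denotes evaluation when the underlying uncertainty has distribution $P$. $\rho^{\rm bp}$ is a risk measure applied to the randomness in $\theta_{-i}$. An equilibrium of the BNE-BPD model (Bayesian Nash equilibrium based on Bayesian predictive distributions) in round $t$ is $f^{t*}\in\mathcal{F}$ such that for every $i\in N$ and $\theta_i\in\Theta_i$, $f_i^{t*}(\theta_i)\in\arg\min_{a_i\in\mathcal{A}_i}\rho^{\rm bp}_{\nu_i^t(\cdot\mid\theta_i)}(c_i(a_i,f_{-i}^{t*}(\theta_{-i}),\theta_i,\theta_{-i}))$. $M$-strong convexity of $g$: $g(\lambda a+(1-\lambda)a')\le\lambda g(a)+(1-\lambda)g(a')-\frac{M}{2}\lambda(1-\lambda)\|a-a'\|^2$ for $\lambda\in[0,1]$.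
   Formalization: The risk measure is additionally assumed convex at the conditional predictive distributions; with only monotonicity and cash invariance the claim fails, e.g. for the essential infimum with loss (a_1 − θ_2)² and θ_2 uniform on [−1,1], a_1 in [−1,1]. *)

theory Defs
  imports "HOL-Analysis.Analysis" "HOL-Probability.Probability_Measure" "Jordan_Normal_Form.Spectral_Radius"
begin

text \<open>
  Players are \<open>1, \<dots>, n\<close>. The dimensions of the individual type and action spaces may differ from
  player to player, so \<open>\<real>\<^sup>d\<close> is represented as the coordinate subspace \<open>span D\<close> of a common Euclidean
  space, where \<open>D \<subseteq> Basis\<close> has \<open>d\<close> elements. Profiles over a set \<open>I\<close> of players are extensional
  functions in \<open>Pi\<^sub>E I\<close>; a profile of the opponents of \<open>i\<close> is one over \<open>others n i\<close>.
\<close>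

definition others :: "nat \<Rightarrow> nat \<Rightarrow> nat set" where
  "others n i = {1..n} - {i}"

text \<open>Lebesgue measure on the coordinate subspace \<open>span D\<close>; for \<open>D = Basis\<close> this is the library's
  definition of \<open>lborel\<close>.\<close>

definition coord_lborel :: "'b::euclidean_space set \<Rightarrow> 'b measure" where
  "coord_lborel D = distr (\<Pi>\<^sub>M b\<in>D. lborel) borel (\<lambda>x. \<Sum>b\<in>D. x b *\<^sub>R b)"

definition type_lborel ::
    "nat set \<Rightarrow> (nat \<Rightarrow> 'b::euclidean_space set) \<Rightarrow> (nat \<Rightarrow> 'b set) \<Rightarrow> (nat \<Rightarrow> 'b) measure" where
  "type_lborel I D \<Theta> = (\<Pi>\<^sub>M j\<in>I. restrict_space (coord_lborel (D j)) (\<Theta> j))"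

subsection \<open>The game\<close>

text \<open>\<open>E i\<close> and \<open>D i\<close> are the coordinates of the action and of the type of player \<open>i\<close>. The arguments of
  \<open>c i\<close> are \<open>a\<^sub>i\<close>, \<open>a\<^sub>-\<^sub>i\<close>, \<open>\<theta>\<^sub>i\<close>, \<open>\<theta>\<^sub>-\<^sub>i\<close>.\<close>

locale bayesian_game =
  fixes n :: nat
    and E :: "nat \<Rightarrow> 'a::euclidean_space set"
    and D :: "nat \<Rightarrow> 'b::euclidean_space set"
    and A :: "nat \<Rightarrow> 'a set"
    and \<Theta> :: "nat \<Rightarrow> 'b set"
    and c :: "nat \<Rightarrow> 'a \<Rightarrow> (nat \<Rightarrow> 'a) \<Rightarrow> 'b \<Rightarrow> (nat \<Rightarrow> 'b) \<Rightarrow> real"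
  assumes players: "1 \<le> n"
    and action_coords: "\<And>i. i \<in> {1..n} \<Longrightarrow> E i \<subseteq> Basis \<and> A i \<subseteq> span (E i)"
    and type_coords: "\<And>i. i \<in> {1..n} \<Longrightarrow> D i \<subseteq> Basis \<and> \<Theta> i \<subseteq> span (D i)"
    and action_spaces: "\<And>i. i \<in> {1..n} \<Longrightarrow> A i \<noteq> {} \<and> compact (A i) \<and> convex (A i)"
    and type_spaces: "\<And>i. i \<in> {1..n} \<Longrightarrow> \<Theta> i \<noteq> {} \<and> compact (\<Theta> i) \<and> convex (\<Theta> i)"
    and loss_continuous: "\<And>i. i \<in> {1..n} \<Longrightarrow>
      continuous_on (A i \<times> Pi\<^sub>E (others n i) A \<times> \<Theta> i \<times> Pi\<^sub>E (others n i) \<Theta>)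
        (\<lambda>(a, b, \<theta>, \<tau>). c i a b \<theta> \<tau>)"

definition strategies :: "(nat \<Rightarrow> 'a::euclidean_space set) \<Rightarrow> (nat \<Rightarrow> 'b::euclidean_space set) \<Rightarrow>
    nat \<Rightarrow> ('b \<Rightarrow> 'a) set" where
  "strategies A \<Theta> i =
     measurable (restrict_space borel (\<Theta> i)) (restrict_space borel (A i)) \<inter> extensional (\<Theta> i)"

text \<open>\<open>f\<^sub>-\<^sub>i(\<theta>\<^sub>-\<^sub>i)\<close>\<close>

definition play :: "nat \<Rightarrow> nat \<Rightarrow> (nat \<Rightarrow> 'b \<Rightarrow> 'a) \<Rightarrow> (nat \<Rightarrow> 'b) \<Rightarrow> nat \<Rightarrow> 'a" where
  "play n i f \<tau> = (\<lambda>j\<in>others n i. f j (\<tau> j))"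

subsection \<open>Beliefs\<close>

text \<open>\<open>p \<zeta>\<close> is the density of \<open>\<eta>(\<cdot>;\<zeta>)\<close>, and \<open>m t i\<close> is the density of player \<open>i\<close>'s belief in round \<open>t\<close>
  with respect to the measure \<open>dz\<close> on the parameter space \<open>space dz\<close>.\<close>

locale belief_model =
  fixes n :: nat
    and D :: "nat \<Rightarrow> 'b::euclidean_space set"
    and \<Theta> :: "nat \<Rightarrow> 'b set"
    and dz :: "'z measure"
    and p :: "'z \<Rightarrow> (nat \<Rightarrow> 'b) \<Rightarrow> real"
    and m :: "nat \<Rightarrow> nat \<Rightarrow> 'z \<Rightarrow> real"
  assumes parameter_space: "sigma_finite_measure dz"
    and p_measurable:
      "(\<lambda>(\<zeta>, \<theta>). p \<zeta> \<theta>) \<in> borel_measurable (dz \<Otimes>\<^sub>M type_lborel {1..n} D \<Theta>)"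
    and p_nonneg: "\<And>\<zeta> \<theta>. \<zeta> \<in> space dz \<Longrightarrow> \<theta> \<in> Pi\<^sub>E {1..n} \<Theta> \<Longrightarrow> 0 \<le> p \<zeta> \<theta>"
    and p_density: "\<And>\<zeta>. \<zeta> \<in> space dz \<Longrightarrow> prob_space (density (type_lborel {1..n} D \<Theta>) (p \<zeta>))"
    and m_measurable: "\<And>t i. i \<in> {1..n} \<Longrightarrow> m t i \<in> borel_measurable dz"
    and m_nonneg: "\<And>t i \<zeta>. i \<in> {1..n} \<Longrightarrow> \<zeta> \<in> space dz \<Longrightarrow> 0 \<le> m t i \<zeta>"
    and m_density: "\<And>t i. i \<in> {1..n} \<Longrightarrow> prob_space (density dz (m t i))"

text \<open>The predictive density \<open>q\<close>, the conditional density \<open>q(\<theta>\<^sub>-\<^sub>i | \<theta>\<^sub>i)\<close> and the conditional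
  distribution \<open>\<nu>(\<cdot> | \<theta>\<^sub>i)\<close> on the types of the opponents, all for one belief density \<open>\<mu>\<close>. The full type
  profile \<open>(\<theta>\<^sub>i, \<theta>\<^sub>-\<^sub>i)\<close> is \<open>\<tau>(i := \<theta>)\<close>. The last two are meaningful where the marginal density of
  \<open>\<theta>\<^sub>i\<close>, the denominator, is positive.\<close>

definition pred_density ::
    "'z measure \<Rightarrow> ('z \<Rightarrow> (nat \<Rightarrow> 'b) \<Rightarrow> real) \<Rightarrow> ('z \<Rightarrow> real) \<Rightarrow> (nat \<Rightarrow> 'b) \<Rightarrow> real" where
  "pred_density dz p \<mu> \<theta> = (\<integral>\<zeta>. p \<zeta> \<theta> * \<mu> \<zeta> \<partial>dz)"

definition cond_pred_density ::
    "nat \<Rightarrow> (nat \<Rightarrow> 'b::euclidean_space set) \<Rightarrow> (nat \<Rightarrow> 'b set) \<Rightarrow> 'z measure \<Rightarrow>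
     ('z \<Rightarrow> (nat \<Rightarrow> 'b) \<Rightarrow> real) \<Rightarrow> ('z \<Rightarrow> real) \<Rightarrow> nat \<Rightarrow> 'b \<Rightarrow> (nat \<Rightarrow> 'b) \<Rightarrow> real" where
  "cond_pred_density n D \<Theta> dz p \<mu> i \<theta> \<tau> =
     pred_density dz p \<mu> (\<tau>(i := \<theta>)) /
     (\<integral>\<tau>'. pred_density dz p \<mu> (\<tau>'(i := \<theta>)) \<partial>type_lborel (others n i) D \<Theta>)"

definition cond_pred ::
    "nat \<Rightarrow> (nat \<Rightarrow> 'b::euclidean_space set) \<Rightarrow> (nat \<Rightarrow> 'b set) \<Rightarrow> 'z measure \<Rightarrow>
     ('z \<Rightarrow> (nat \<Rightarrow> 'b) \<Rightarrow> real) \<Rightarrow> ('z \<Rightarrow> real) \<Rightarrow> nat \<Rightarrow> 'b \<Rightarrow> (nat \<Rightarrow> 'b) measure" where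
  "cond_pred n D \<Theta> dz p \<mu> i \<theta> =
     density (type_lborel (others n i) D \<Theta>) (cond_pred_density n D \<Theta> dz p \<mu> i \<theta>)"

subsection \<open>Risk measures\<close>

definition random_losses :: "'w measure \<Rightarrow> ('w \<Rightarrow> real) set" where
  "random_losses P = {\<xi> \<in> borel_measurable P. bounded (\<xi> ` space P)}"

text \<open>Monotonicity is only required for the pointwise order; monotonicity for the almost sure order
  under \<open>P\<close> implies it.\<close>

definition risk_measure :: "'w measure \<Rightarrow> (('w \<Rightarrow> real) \<Rightarrow> real) \<Rightarrow> bool" where
  "risk_measure P \<rho> \<longleftrightarrow>
     (\<forall>\<xi>\<in>random_losses P. \<forall>\<xi>'\<in>random_losses P.
        (\<forall>\<omega>\<in>space P. \<xi> \<omega> \<le> \<xi>' \<omega>) \<longrightarrow> \<rho> \<xi> \<le> \<rho> \<xi>') \<and>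
     (\<forall>\<xi>\<in>random_losses P. \<forall>k. \<rho> (\<lambda>\<omega>. \<xi> \<omega> + k) = \<rho> \<xi> + k)"

definition convex_functional :: "'w measure \<Rightarrow> (('w \<Rightarrow> real) \<Rightarrow> real) \<Rightarrow> bool" where
  "convex_functional P \<rho> \<longleftrightarrow>
     (\<forall>\<xi>\<in>random_losses P. \<forall>\<xi>'\<in>random_losses P. \<forall>l\<in>{0..1}.
        \<rho> (\<lambda>\<omega>. l * \<xi> \<omega> + (1 - l) * \<xi>' \<omega>) \<le> l * \<rho> \<xi> + (1 - l) * \<rho> \<xi>')"

subsection \<open>Equilibria\<close>

text \<open>\<open>\<nu> i \<theta>\<^sub>i\<close> is the distribution of \<open>\<theta>\<^sub>-\<^sub>i\<close> that player \<open>i\<close> of type \<open>\<theta>\<^sub>i\<close> uses.\<close>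

definition bne_bpd ::
    "nat \<Rightarrow> (nat \<Rightarrow> 'a::euclidean_space set) \<Rightarrow> (nat \<Rightarrow> 'b::euclidean_space set) \<Rightarrow>
     (nat \<Rightarrow> 'a \<Rightarrow> (nat \<Rightarrow> 'a) \<Rightarrow> 'b \<Rightarrow> (nat \<Rightarrow> 'b) \<Rightarrow> real) \<Rightarrow>
     (nat \<Rightarrow> (nat \<Rightarrow> 'b) measure \<Rightarrow> ((nat \<Rightarrow> 'b) \<Rightarrow> real) \<Rightarrow> real) \<Rightarrow>
     (nat \<Rightarrow> 'b \<Rightarrow> (nat \<Rightarrow> 'b) measure) \<Rightarrow> (nat \<Rightarrow> 'b \<Rightarrow> 'a) \<Rightarrow> bool" where
  "bne_bpd n A \<Theta> c \<rho> \<nu> f \<longleftrightarrow>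
     f \<in> Pi\<^sub>E {1..n} (strategies A \<Theta>) \<and>
     (\<forall>i\<in>{1..n}. \<forall>\<theta>\<in>\<Theta> i.
        is_arg_min (\<lambda>a. \<rho> i (\<nu> i \<theta>) (\<lambda>\<tau>. c i a (play n i f \<tau>) \<theta> \<tau>)) (\<lambda>a. a \<in> A i) (f i \<theta>))"

subsection \<open>Strong convexity and gradients\<close>

definition strongly_convex_on :: "real \<Rightarrow> 'a::real_normed_vector set \<Rightarrow> ('a \<Rightarrow> real) \<Rightarrow> bool" where
  "strongly_convex_on M S g \<longleftrightarrow>
     (\<forall>a\<in>S. \<forall>a'\<in>S. \<forall>l\<in>{0..1}.
        g (l *\<^sub>R a + (1 - l) *\<^sub>R a') \<le>
          l * g a + (1 - l) * g a' - M / 2 * l * (1 - l) * (norm (a - a'))\<^sup>2)"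

text \<open>The losses are only given on the action sets, so differentiability is relative to the set \<open>S\<close> of
  actions. The gradient \<open>v\<close> lies in the coordinate space \<open>V\<close>; it is unique if \<open>S\<close> is a convex subset of
  \<open>V\<close> with nonempty interior relative to \<open>V\<close>.\<close>

definition has_gradient_on ::
    "('a::euclidean_space \<Rightarrow> real) \<Rightarrow> 'a \<Rightarrow> 'a set \<Rightarrow> 'a set \<Rightarrow> 'a \<Rightarrow> bool" where
  "has_gradient_on g v V S x \<longleftrightarrow> v \<in> V \<and> (g has_derivative (\<lambda>h. v \<bullet> h)) (at x within S)"

subsection \<open>The interaction matrix\<close>

definition K_bp :: "(nat \<Rightarrow> real) \<Rightarrow> (nat \<Rightarrow> real) \<Rightarrow> (nat \<Rightarrow> nat \<Rightarrow> real) \<Rightarrow> (nat \<Rightarrow> nat \<Rightarrow> real) \<Rightarrow>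
    nat \<Rightarrow> nat \<Rightarrow> real" where
  "K_bp \<kappa>0 \<kappa>1 L0 L1 i j = (if j = i then 0 else \<kappa>1 i * L1 i j + \<kappa>0 i * L0 i j)"

text \<open>Matrix indices start at 0, players at 1. The entries are complex because that is the type of
  matrices for which \<open>spectral_radius\<close> is defined.\<close>

definition Gamma_bp :: "nat \<Rightarrow> (nat \<Rightarrow> nat \<Rightarrow> real) \<Rightarrow> (nat \<Rightarrow> real) \<Rightarrow> complex Matrix.mat" where
  "Gamma_bp n K M = Matrix.mat n n (\<lambda>(r, s). complex_of_real (K (Suc r) (Suc s) / M (Suc r)))"

end

theory Submission
  imports Defs
begin

text \<open>
  The risk measure inherits strong convexity in the own action from the loss: apply the risk measure
  to the pointwise inequality and use monotonicity, cash invariance and convexity. Strong convexity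
  makes the minimiser stable: if two objectives are minimised at \<open>x\<close> and \<open>y\<close>, then \<open>M \<parallel>x - y\<parallel>\<close> is at
  most the distance of their gradients at \<open>y\<close>. For two equilibria \<open>f\<close> and \<open>f'\<close> the sup distances
  \<open>d\<^sub>i = sup \<parallel>f\<^sub>i - f'\<^sub>i\<parallel>\<close> therefore satisfy \<open>d \<le> \<Gamma> d\<close>. Choose \<open>s\<close> with \<open>r(\<Gamma>) < s < 1\<close>; the powers of
  \<open>\<Gamma> / s\<close> are bounded, so \<open>d \<le> \<Gamma>\<^sup>k d = s\<^sup>k (\<Gamma> / s)\<^sup>k d\<close> tends to \<open>0\<close> with \<open>k\<close>.
\<close>

section \<open>Subinvariant vectors of nonnegative matrices with spectral radius below 1\<close>

text \<open>An eigenvector of \<open>A / s\<close> for \<open>k\<close> is one of \<open>A\<close>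
  for \<open>s * k\<close>, so \<open>s * norm k \<le> spectral_radius A < s\<close>; this is
  applied to an eigenvalue of largest modulus.\<close>

lemma spectral_radius_smult_less_1:
  fixes A :: "complex mat"
  assumes A: "A \<in> carrier_mat n n" and n: "0 < n"
    and s: "spectral_radius A < s" "0 < s"
  shows "spectral_radius (complex_of_real (1 / s) \<cdot>\<^sub>m A) < 1"
proof -
  let ?B = "complex_of_real (1 / s) \<cdot>\<^sub>m A"
  have B: "?B \<in> carrier_mat n n" using A by simp
  obtain k where k: "k \<in> spectrum ?B" "spectral_radius ?B = norm k"
    using spectral_radius_mem_max(1)[OF B n] by auto
  then obtain v where v: "eigenvector ?B v k"
    unfolding spectrum_def eigenvalue_def by auto
  have "eigenvector A v (complex_of_real s * k)"
  proof -
    have vc: "v \<in> carrier_vec n" "v \<noteq> 0\<^sub>v n" and Bv: "?B *\<^sub>v v = k \<cdot>\<^sub>v v"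
      using v A unfolding eigenvector_def by auto
    have "A *\<^sub>v v = (complex_of_real s * k) \<cdot>\<^sub>v v"
    proof (rule eq_vecI)
      fix j assume "j < dim_vec ((complex_of_real s * k) \<cdot>\<^sub>v v)"
      then have j: "j < n" using vc by simp
      have "(?B *\<^sub>v v) $ j = k * v $ j" unfolding Bv using vc j by simp
      moreover have "(?B *\<^sub>v v) $ j = complex_of_real (1 / s) * (A *\<^sub>v v) $ j"
        using vc j A by (simp)
      ultimately show "(A *\<^sub>v v) $ j = ((complex_of_real s * k) \<cdot>\<^sub>v v) $ j"
        using vc j s by (simp add: field_simps)
    qed (use A vc in auto)
    then show ?thesis using vc A unfolding eigenvector_def by auto
  qed
  then have "norm (complex_of_real s * k) \<le> spectral_radius A"
    by (intro spectral_radius_mem_max(2)[OF A n] imageI) (auto simp: spectrum_def eigenvalue_def)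
  then have "s * norm k \<le> spectral_radius A" using s by (simp add: norm_mult)
  then have "s * norm k < s" using s(1) by linarith
  then show ?thesis unfolding k(2) using s by simp
qed

text \<open>The bound on \<open>x\<close> is substituted into itself \<open>k\<close> times. Each
  substitution happens under a sum weighted by entries of the power, so their nonnegativity is
  carried through the same induction.\<close>

lemma subinvariant_pow_mat:
  fixes H :: "real mat"
  assumes H: "H \<in> carrier_mat n n"
    and H_nonneg: "\<And>r u. r < n \<Longrightarrow> u < n \<Longrightarrow> 0 \<le> H $$ (r, u)"
    and x: "\<And>r. r < n \<Longrightarrow> x r \<le> s * (\<Sum>u<n. H $$ (r, u) * x u)" and s: "0 \<le> s"
  shows "r < n \<Longrightarrow> (\<forall>u<n. 0 \<le> (H ^\<^sub>m k) $$ (r, u)) \<and>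
    x r \<le> s ^ k * (\<Sum>u<n. (H ^\<^sub>m k) $$ (r, u) * x u)"
proof (induction k)
  case 0
  have "(\<Sum>u<n. (1\<^sub>m n) $$ (r, u) * x u) = (\<Sum>u<n. if u = r then x u else 0)"
    using 0 by (intro sum.cong) auto
  then show ?case using 0 H by auto
next
  case (Suc k)
  let ?P = "H ^\<^sub>m k"
  have P: "?P \<in> carrier_mat n n" using H by simp
  \<comment> \<open>Powers grow by a factor \<open>H\<close> on the right, so inserting the bound on
    \<open>x\<close> behind the \<open>k\<close>-th power yields precisely the next one.\<close>
  have entry: "(H ^\<^sub>m Suc k) $$ (r, u) = (\<Sum>v<n. ?P $$ (r, v) * H $$ (v, u))" if "u < n" for u
    using that Suc.prems P H by (auto simp: scalar_prod_def lessThan_atLeast0 intro!: sum.cong)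
  have nonneg: "\<forall>u<n. 0 \<le> (H ^\<^sub>m Suc k) $$ (r, u)"
    using Suc H_nonneg by (auto simp: entry simp del: pow_mat.simps intro!: sum_nonneg)
  have "x r \<le> s ^ k * (\<Sum>v<n. ?P $$ (r, v) * x v)" using Suc by simp
  also have "\<dots> \<le> s ^ k * (\<Sum>v<n. ?P $$ (r, v) * (s * (\<Sum>u<n. H $$ (v, u) * x u)))"
    using Suc s x by (intro mult_left_mono sum_mono) auto
  also have "\<dots> = s ^ Suc k * (\<Sum>v<n. \<Sum>u<n. ?P $$ (r, v) * H $$ (v, u) * x u)"
    by (simp add: sum_distrib_left mult_ac)
  also have "\<dots> = s ^ Suc k * (\<Sum>u<n. (H ^\<^sub>m Suc k) $$ (r, u) * x u)"
    by (subst sum.swap) (simp add: entry sum_distrib_right del: pow_mat.simps)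
  finally show ?case using nonneg by blast
qed

lemma subinvariant_imp_zero:
  fixes G :: "nat \<Rightarrow> nat \<Rightarrow> real"
  assumes G: "\<And>r u. r < n \<Longrightarrow> u < n \<Longrightarrow> 0 \<le> G r u"
    and sr: "spectral_radius (Matrix.mat n n (\<lambda>(r, u). complex_of_real (G r u))) < 1"
    and x_nonneg: "\<And>r. r < n \<Longrightarrow> 0 \<le> x r"
    and x: "\<And>r. r < n \<Longrightarrow> x r \<le> (\<Sum>u<n. G r u * x u)"
    and r: "r < n"
  shows "x r = 0"
proof -
  define A where "A = Matrix.mat n n (\<lambda>(r, u). complex_of_real (G r u))"
  have A: "A \<in> carrier_mat n n" by (simp add: A_def)
  have n: "0 < n" using r by simp
  \<comment> \<open>The maximum with 0 gives \<open>0 < s\<close> at once, as division by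
    \<open>s\<close> requires.\<close>
  obtain s where s: "max 0 (spectral_radius A) < s" "s < 1"
    using dense[of "max 0 (spectral_radius A)" 1] sr by (auto simp: A_def)
  \<comment> \<open>The iteration compares entries and so needs a real matrix, while the spectrum is
    complex; \<open>complex_of_real\<close> links the two and commutes with powers.\<close>
  define H where "H = Matrix.mat n n (\<lambda>(r, u). G r u / s)"
  have H: "H \<in> carrier_mat n n" by (simp add: H_def)
  have B: "map_mat complex_of_real H = complex_of_real (1 / s) \<cdot>\<^sub>m A"
    by (rule eq_matI) (auto simp: H_def A_def)
  have "spectral_radius (map_mat complex_of_real H) < 1"
    unfolding B using s A n by (intro spectral_radius_smult_less_1) auto
  \<comment> \<open>Via the Jordan normal form, spectral radius below 1 bounds the entries of all
    powers by one constant.\<close>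
  then obtain b where b: "\<And>k. norm_bound (map_mat complex_of_real H ^\<^sub>m k) b"
    using spectral_radius_jnf_norm_bound_less_1_upper_triangular[of "map_mat complex_of_real H" n] H
    by auto
  have bound: "\<bar>(H ^\<^sub>m k) $$ (r, u)\<bar> \<le> b" if "u < n" for k u
  proof -
    have "map_mat complex_of_real H ^\<^sub>m k = map_mat complex_of_real (H ^\<^sub>m k)"
      using of_real_hom.mat_hom_pow[OF H] by metis
    then have "norm_bound (map_mat complex_of_real (H ^\<^sub>m k)) b" using b[of k] by simp
    then have "norm (map_mat complex_of_real (H ^\<^sub>m k) $$ (r, u)) \<le> b"
      unfolding norm_bound_def using that r H by simp
    then show ?thesis using that r H by simp
  qed
  have le: "x r \<le> s ^ k * (\<Sum>u<n. b * x u)" for k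
  proof -
    have "x r \<le> s ^ k * (\<Sum>u<n. (H ^\<^sub>m k) $$ (r, u) * x u)"
    proof (rule conjunct2[OF subinvariant_pow_mat[OF H _ _ _ r]])
      show "x v \<le> s * (\<Sum>u<n. H $$ (v, u) * x u)" if "v < n" for v
        using x[OF that] that s by (simp add: H_def sum_distrib_left)
    qed (use s G in \<open>auto simp: H_def\<close>)
    \<comment> \<open>As \<open>x\<close> is nonnegative, each entry of the power may be replaced by
      its bound; the sum then no longer depends on \<open>k\<close>.\<close>
    also have "\<dots> \<le> s ^ k * (\<Sum>u<n. b * x u)"
      using bound x_nonneg s by (intro mult_left_mono sum_mono mult_right_mono) (auto simp: abs_le_iff)
    finally show ?thesis .
  qed
  have "(\<lambda>k. s ^ k * (\<Sum>u<n. b * x u)) \<longlonglongrightarrow> 0 * (\<Sum>u<n. b * x u)"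
    using s by (intro tendsto_intros LIMSEQ_realpow_zero) auto
  then have "x r \<le> 0" using le by (intro LIMSEQ_le_const) auto
  then show ?thesis using x_nonneg[OF r] by simp
qed

section \<open>Strong convexity, gradients and minimisers\<close>

text \<open>Minimality puts \<open>g x\<close> below the values on the segment from \<open>x\<close>
  to \<open>y\<close>, and strong convexity bounds these from above. Dividing by the weight
  \<open>1 - l\<close> of \<open>y\<close> and letting \<open>l\<close> tend to 1 leaves the
  quadratic gap.\<close>

lemma strongly_convex_on_minimizer_growth:
  assumes g: "strongly_convex_on M S g" and S: "convex S" and x: "is_arg_min g (\<lambda>a. a \<in> S) x"
    and y: "y \<in> S"
  shows "g x + M / 2 * (norm (y - x))\<^sup>2 \<le> g y"
proof -
  have xS: "x \<in> S" and min: "\<And>z. z \<in> S \<Longrightarrow> g x \<le> g z"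
    using x by (auto simp: is_arg_min_linorder)
  have "l * (M / 2 * (norm (y - x))\<^sup>2) \<le> g y - g x" if l: "0 < l" "l < 1" for l
  proof -
    have "g x \<le> g ((1 - l) *\<^sub>R y + l *\<^sub>R x)"
      using l S xS y by (intro min convexD) auto
    also have "\<dots> \<le> (1 - l) * g y + l * g x - M / 2 * (1 - l) * l * (norm (y - x))\<^sup>2"
      using g[unfolded strongly_convex_on_def, rule_format, OF y xS, of "1 - l"] l by simp
    finally have "(1 - l) * (l * (M / 2 * (norm (y - x))\<^sup>2)) \<le> (1 - l) * (g y - g x)"
      by (simp add: algebra_simps)
    then show ?thesis using l by (simp add: mult_le_cancel_left_pos)
  qed
  from field_le_mult_one_interval[OF this] show ?thesis by simp
qed

text \<open>The derivative only sees points of \<open>S\<close>. Convexity keeps the segment from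
  \<open>x\<close> to \<open>y\<close> in \<open>S\<close>, so the chain rule along it gives a
  one-sided limit, even at boundary points.\<close>

lemma tendsto_directional_quotient:
  fixes v :: "'a::euclidean_space"
  assumes g: "(g has_derivative (\<lambda>h. inner v h)) (at x within S)"
    and S: "convex S" "x \<in> S" "y \<in> S"
  shows "((\<lambda>s. (g (x + s *\<^sub>R (y - x)) - g x) / s) \<longlongrightarrow> inner v (y - x)) (at_right (0::real))"
proof -
  let ?p = "\<lambda>s. x + s *\<^sub>R (y - x)"
  have im: "?p ` {0..1} \<subseteq> S"
  proof clarsimp
    fix s :: real assume "0 \<le> s" "s \<le> 1"
    then have "(1 - s) *\<^sub>R x + s *\<^sub>R y \<in> S" using S by (intro convexD) auto
    then show "?p s \<in> S" by (simp add: algebra_simps)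
  qed
  have "(?p has_derivative (\<lambda>s. s *\<^sub>R (y - x))) (at 0 within {0..1})"
    by (auto intro!: derivative_eq_intros)
  moreover have "(g has_derivative (\<lambda>h. inner v h)) (at (?p 0) within ?p ` {0..1})"
    using has_derivative_subset[OF g im] by simp
  ultimately have "((\<lambda>s. g (?p s)) has_derivative (\<lambda>s. inner v (s *\<^sub>R (y - x)))) (at 0 within {0..1})"
    by (rule has_derivative_in_compose)
  then have "((\<lambda>s. g (?p s)) has_real_derivative inner v (y - x)) (at 0 within {0..1})"
    by (simp add: has_field_derivative_def mult.commute[of _ "inner v (y - x)"])
  then show ?thesis by (simp add: has_field_derivative_iff at_within_Icc_at_right)
qed

text \<open>Strong convexity on the segment bounds the difference quotient from above; its limit at
  0 is the directional derivative.\<close>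

lemma strongly_convex_on_gradient:
  fixes v :: "'a::euclidean_space"
  assumes g: "strongly_convex_on M S g" and d: "(g has_derivative (\<lambda>h. inner v h)) (at x within S)"
    and S: "convex S" "x \<in> S" "y \<in> S"
  shows "g x + inner v (y - x) + M / 2 * (norm (y - x))\<^sup>2 \<le> g y"
proof -
  \<comment> \<open>\<open>1 - 0\<close> is the literal limit of the factor \<open>1 - s\<close>, so
    the full constant \<open>M / 2\<close> survives.\<close>
  have "inner v (y - x) \<le> g y - g x - M / 2 * (1 - 0) * (norm (y - x))\<^sup>2"
  proof (rule tendsto_le[OF _ _ tendsto_directional_quotient[OF d S]])
    show "((\<lambda>s. g y - g x - M / 2 * (1 - s) * (norm (y - x))\<^sup>2) \<longlongrightarrow>
        g y - g x - M / 2 * (1 - 0) * (norm (y - x))\<^sup>2) (at_right 0)"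
      by (intro tendsto_intros)
    have "(g (x + s *\<^sub>R (y - x)) - g x) / s \<le> g y - g x - M / 2 * (1 - s) * (norm (y - x))\<^sup>2"
      if s: "0 < s" "s < 1" for s
    proof -
      have "g (s *\<^sub>R y + (1 - s) *\<^sub>R x) \<le> s * g y + (1 - s) * g x - M / 2 * s * (1 - s) * (norm (y - x))\<^sup>2"
        using g S s unfolding strongly_convex_on_def by auto
      moreover have "s *\<^sub>R y + (1 - s) *\<^sub>R x = x + s *\<^sub>R (y - x)" by (simp add: algebra_simps)
      ultimately show ?thesis using s by (simp add: field_simps)
    qed
    then show "\<forall>\<^sub>F s in at_right 0. (g (x + s *\<^sub>R (y - x)) - g x) / s
        \<le> g y - g x - M / 2 * (1 - s) * (norm (y - x))\<^sup>2"
      using eventually_at_right_less[of 0] by (auto simp: eventually_at_right_field intro!: exI[of _ 1])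
  qed simp
  then show ?thesis by simp
qed

text \<open>First-order optimality as a variational inequality, since a minimiser on the boundary
  may have a nonzero gradient: difference quotients from a minimiser into \<open>S\<close> are
  nonnegative.\<close>

lemma arg_min_gradient_nonneg:
  fixes v :: "'a::euclidean_space"
  assumes x: "is_arg_min g (\<lambda>a. a \<in> S) x" and d: "(g has_derivative (\<lambda>h. inner v h)) (at x within S)"
    and S: "convex S" "y \<in> S"
  shows "0 \<le> inner v (y - x)"
proof -
  have xS: "x \<in> S" and min: "\<And>z. z \<in> S \<Longrightarrow> g x \<le> g z"
    using x by (auto simp: is_arg_min_linorder)
  have "0 \<le> (g (x + s *\<^sub>R (y - x)) - g x) / s" if s: "0 < s" "s < 1" for s
  proof -
    have "(1 - s) *\<^sub>R x + s *\<^sub>R y \<in> S" using S xS s by (intro convexD) auto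
    then have "x + s *\<^sub>R (y - x) \<in> S" by (simp add: algebra_simps)
    then show ?thesis using min s by simp
  qed
  then have "\<forall>\<^sub>F s in at_right 0. 0 \<le> (g (x + s *\<^sub>R (y - x)) - g x) / s"
    by (auto simp: eventually_at_right_field intro!: exI[of _ 1])
  then show ?thesis
    using tendsto_lowerbound[OF tendsto_directional_quotient[OF d S(1) xS S(2)]] by simp
qed

text \<open>The gradient inequality of \<open>g\<close> at \<open>y\<close> and the growth of
  \<open>g\<close> away from \<open>x\<close> contribute \<open>M / 2\<close> each: \<open>M\<close>
  times the squared distance is at most \<open>- inner u (x - y)\<close>. Optimality of
  \<open>y\<close> for \<open>h\<close> allows adding \<open>inner w (x - y)\<close>; Cauchy-Schwarz
  and cancellation finish.\<close>

lemma arg_min_dist_le_gradient_dist: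
  fixes u w :: "'a::euclidean_space"
  assumes g: "strongly_convex_on M S g" and S: "convex S"
    and x: "is_arg_min g (\<lambda>a. a \<in> S) x" and y: "is_arg_min h (\<lambda>a. a \<in> S) y"
    and u: "(g has_derivative (\<lambda>z. inner u z)) (at y within S)"
    and w: "(h has_derivative (\<lambda>z. inner w z)) (at y within S)"
  shows "M * norm (x - y) \<le> norm (u - w)"
proof (cases "x = y")
  case False
  have xy: "x \<in> S" "y \<in> S" using x y by (auto simp: is_arg_min_linorder)
  have "g y + inner u (x - y) + M / 2 * (norm (x - y))\<^sup>2 \<le> g x"
    by (rule strongly_convex_on_gradient[OF g u S xy(2,1)])
  moreover have "g x + M / 2 * (norm (y - x))\<^sup>2 \<le> g y"
    by (rule strongly_convex_on_minimizer_growth[OF g S x xy(2)])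
  moreover have "0 \<le> inner w (x - y)" by (rule arg_min_gradient_nonneg[OF y w S xy(1)])
  ultimately have "M * (norm (x - y))\<^sup>2 \<le> inner (w - u) (x - y)"
    by (simp add: norm_minus_commute inner_diff_left)
  also have "\<dots> \<le> norm (u - w) * norm (x - y)"
    by (metis norm_cauchy_schwarz norm_minus_commute)
  finally have "norm (x - y) * (M * norm (x - y)) \<le> norm (x - y) * norm (u - w)"
    by (simp add: power2_eq_square mult_ac)
  then show ?thesis using False by (simp add: mult_le_cancel_left_pos)
qed simp

section \<open>Strongly convex losses under a risk measure\<close>

lemma random_losses_convex_combination:
  assumes x: "\<xi> \<in> random_losses P" and x': "\<xi>' \<in> random_losses P"
  shows "(\<lambda>\<omega>. l * \<xi> \<omega> + k * \<xi>' \<omega> + e) \<in> random_losses P"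
proof -
  obtain B B' where B: "\<forall>\<omega>\<in>space P. \<bar>\<xi> \<omega>\<bar> \<le> B" and B': "\<forall>\<omega>\<in>space P. \<bar>\<xi>' \<omega>\<bar> \<le> B'"
    using x x' by (auto simp: random_losses_def bounded_iff)
  have "\<bar>l * \<xi> \<omega> + k * \<xi>' \<omega> + e\<bar> \<le> \<bar>l\<bar> * B + \<bar>k\<bar> * B' + \<bar>e\<bar>" if w: "\<omega> \<in> space P" for \<omega>
  proof -
    have "\<bar>l * \<xi> \<omega>\<bar> \<le> \<bar>l\<bar> * B" "\<bar>k * \<xi>' \<omega>\<bar> \<le> \<bar>k\<bar> * B'"
      using B B' w by (auto simp: abs_mult intro!: mult_left_mono)
    then show ?thesis by linarith
  qed
  then have "bounded ((\<lambda>\<omega>. l * \<xi> \<omega> + k * \<xi>' \<omega> + e) ` space P)"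
    by (auto simp: bounded_iff)
  moreover have "(\<lambda>\<omega>. l * \<xi> \<omega> + k * \<xi>' \<omega> + e) \<in> borel_measurable P"
    using x x' by (auto simp: random_losses_def)
  ultimately show ?thesis by (simp add: random_losses_def)
qed

lemma strongly_convex_on_risk:
  assumes \<rho>: "risk_measure P \<rho>" "convex_functional P \<rho>" and S: "convex S"
    and \<xi>: "\<And>a. a \<in> S \<Longrightarrow> \<xi> a \<in> random_losses P"
    and sc: "\<And>\<omega>. \<omega> \<in> space P \<Longrightarrow> strongly_convex_on M S (\<lambda>a. \<xi> a \<omega>)"
  shows "strongly_convex_on M S (\<lambda>a. \<rho> (\<xi> a))"
  unfolding strongly_convex_on_def
proof (intro ballI)
  fix a a' l assume a: "a \<in> S" "a' \<in> S" and l: "l \<in> {0..1::real}"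
  \<comment> \<open>The quadratic term is the same in every state, so it is a cash amount that cash
    invariance moves out of \<open>\<rho>\<close>.\<close>
  define k where "k = - (M / 2 * l * (1 - l) * (norm (a - a'))\<^sup>2)"
  let ?mix = "\<lambda>\<omega>. l * \<xi> a \<omega> + (1 - l) * \<xi> a' \<omega>"
  \<comment> \<open>Cash invariance is applied to the mixture, monotonicity to the shifted mixture;
    both must be admissible losses.\<close>
  have mix: "?mix \<in> random_losses P" "(\<lambda>\<omega>. ?mix \<omega> + k) \<in> random_losses P"
    using random_losses_convex_combination[OF \<xi>[OF a(1)] \<xi>[OF a(2)], of l "1 - l" 0]
      random_losses_convex_combination[OF \<xi>[OF a(1)] \<xi>[OF a(2)], of l "1 - l" k] by simp_all
  have comb: "l *\<^sub>R a + (1 - l) *\<^sub>R a' \<in> S"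
    using S a l by (intro convexD) auto
  have "\<rho> (\<xi> (l *\<^sub>R a + (1 - l) *\<^sub>R a')) \<le> \<rho> (\<lambda>\<omega>. ?mix \<omega> + k)"
  proof -
    have "\<forall>\<omega>\<in>space P. \<xi> (l *\<^sub>R a + (1 - l) *\<^sub>R a') \<omega> \<le> ?mix \<omega> + k"
      using sc a l by (simp add: strongly_convex_on_def k_def)
    then show ?thesis
      using \<rho>(1)[unfolded risk_measure_def, THEN conjunct1, rule_format, OF \<xi>[OF comb] mix(2)] by simp
  qed
  also have "\<dots> = \<rho> ?mix + k" using \<rho>(1) mix(1) by (simp add: risk_measure_def)
  also have "\<dots> \<le> l * \<rho> (\<xi> a) + (1 - l) * \<rho> (\<xi> a') + k"
    using \<rho>(2) \<xi> a l unfolding convex_functional_def by auto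
  finally show "\<rho> (\<xi> (l *\<^sub>R a + (1 - l) *\<^sub>R a'))
      \<le> l * \<rho> (\<xi> a) + (1 - l) * \<rho> (\<xi> a') - M / 2 * l * (1 - l) * (norm (a - a'))\<^sup>2"
    by (simp add: k_def)
qed

section \<open>Compactness and measurability of profiles, and admissibility of the induced
  losses\<close>

text \<open>Extensional profiles form a full product whose factors outside \<open>I\<close> are
  \<open>{undefined}\<close>, so Tychonoff's theorem applies.\<close>

lemma compact_PiE:
  fixes S :: "'i \<Rightarrow> 'a::t2_space set"
  assumes "\<And>i. i \<in> I \<Longrightarrow> compact (S i)"
  shows "compact (Pi\<^sub>E I S)"
proof -
  have "Pi\<^sub>E I S = Pi\<^sub>E UNIV (\<lambda>i. if i \<in> I then S i else {undefined})"
    by (auto simp: PiE_iff extensional_def split: if_split_asm)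
  moreover have "compactin (product_topology (\<lambda>i. euclidean) UNIV)
      (Pi\<^sub>E UNIV (\<lambda>i. if i \<in> I then S i else {undefined}))"
    unfolding compactin_PiE using assms by auto
  ultimately show ?thesis by (simp add: euclidean_product_topology)
qed

lemma space_type_lborel: "space (type_lborel I D \<Theta>) = Pi\<^sub>E I \<Theta>"
  by (simp add: type_lborel_def space_PiM space_restrict_space coord_lborel_def)

text \<open>Measurability ignores the measures on the factors, so it can be argued with restricted
  Borel spaces for any \<open>D\<close>.\<close>

lemma sets_type_lborel:
  "sets (type_lborel I D \<Theta>) = sets (\<Pi>\<^sub>M j\<in>I. restrict_space borel (\<Theta> j))"
  unfolding type_lborel_def
  by (intro sets_PiM_cong refl sets_restrict_space_cong) (simp add: coord_lborel_def)

lemma measurable_type_lborel_component: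
  assumes "j \<in> I"
  shows "(\<lambda>\<tau>. \<tau> j) \<in> measurable (type_lborel I D \<Theta>) (restrict_space borel (\<Theta> j))"
  unfolding measurable_cong_sets[OF sets_type_lborel refl]
  by (rule measurable_component_singleton[OF assms])

text \<open>Measurability into a countable product is coordinatewise, and coordinates outside
  \<open>I\<close> are constantly \<open>undefined\<close>.\<close>

lemma borel_measurable_profile:
  fixes g :: "'w \<Rightarrow> 'i::countable \<Rightarrow> 'a::second_countable_topology"
  assumes "\<And>j. j \<in> I \<Longrightarrow> (\<lambda>\<omega>. g \<omega> j) \<in> borel_measurable P"
    and "\<And>\<omega>. \<omega> \<in> space P \<Longrightarrow> g \<omega> \<in> extensional I"
  shows "g \<in> borel_measurable P"
proof (rule measurable_coordinatewise_then_product)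
  fix j
  show "(\<lambda>\<omega>. g \<omega> j) \<in> borel_measurable P"
  proof (cases "j \<in> I")
    case False
    then have "(\<lambda>\<omega>. g \<omega> j) \<in> borel_measurable P \<longleftrightarrow> (\<lambda>\<omega>. undefined :: 'a) \<in> borel_measurable P"
      using assms(2) by (intro measurable_cong) (auto simp: extensional_def)
    then show ?thesis by simp
  qed (use assms(1) in auto)
qed

lemma strategies_mem: "f \<in> strategies A \<Theta> j \<Longrightarrow> \<theta> \<in> \<Theta> j \<Longrightarrow> f \<theta> \<in> A j"
  by (auto simp: strategies_def space_restrict_space dest: measurable_space)

lemma play_mem:
  assumes "\<And>j. j \<in> others n i \<Longrightarrow> f j \<in> strategies A \<Theta> j" "\<tau> \<in> Pi\<^sub>E (others n i) \<Theta>"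
  shows "play n i f \<tau> \<in> Pi\<^sub>E (others n i) A"
  unfolding play_def
proof (rule restrict_PiE_iff[THEN iffD2], rule ballI)
  fix j assume j: "j \<in> others n i"
  show "f j (\<tau> j) \<in> A j"
    by (rule strategies_mem[OF assms(1)[OF j] PiE_mem[OF assms(2) j]])
qed

lemma play_borel_measurable:
  assumes "\<And>j. j \<in> others n i \<Longrightarrow> f j \<in> strategies A \<Theta> j"
  shows "play n i f \<in> borel_measurable (type_lborel (others n i) D \<Theta>)"
proof (rule borel_measurable_profile)
  fix j assume j: "j \<in> others n i"
  have "f j \<in> measurable (restrict_space borel (\<Theta> j)) (restrict_space borel (A j))"
    using assms[OF j] by (simp add: strategies_def)
  then have "f j \<in> borel_measurable (restrict_space borel (\<Theta> j))"
    by (simp add: measurable_restrict_space2_iff)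
  then have "(\<lambda>\<tau>. f j (\<tau> j)) \<in> borel_measurable (type_lborel (others n i) D \<Theta>)"
    by (rule measurable_compose[OF measurable_type_lborel_component[OF j]])
  then show "(\<lambda>\<tau>. play n i f \<tau> j) \<in> borel_measurable (type_lborel (others n i) D \<Theta>)"
    using j by (simp add: play_def)
qed (simp add: play_def)

text \<open>Continuity of the loss on its domain gives measurability, compactness of that domain
  boundedness. Only the sigma-algebra of \<open>P\<close> enters, so every density over
  \<open>type_lborel\<close> qualifies.\<close>

lemma (in bayesian_game) loss_random:
  assumes i: "i \<in> {1..n}" and f: "\<And>j. j \<in> others n i \<Longrightarrow> f j \<in> strategies A \<Theta> j"
    and a: "a \<in> A i" and \<theta>: "\<theta> \<in> \<Theta> i"
    and P: "sets P = sets (type_lborel (others n i) D \<Theta>)"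
  shows "(\<lambda>\<tau>. c i a (play n i f \<tau>) \<theta> \<tau>) \<in> random_losses P"
proof -
  let ?T = "A i \<times> Pi\<^sub>E (others n i) A \<times> \<Theta> i \<times> Pi\<^sub>E (others n i) \<Theta>"
  let ?h = "\<lambda>\<tau>. (a, play n i f \<tau>, \<theta>, \<tau>)"
  let ?c = "\<lambda>(a, b, \<theta>, \<tau>). c i a b \<theta> \<tau>"
  have space: "space P = Pi\<^sub>E (others n i) \<Theta>"
    using sets_eq_imp_space_eq[OF P] by (simp add: space_type_lborel)
  have h: "?h \<tau> \<in> ?T" if "\<tau> \<in> space P" for \<tau>
    using that a \<theta> play_mem[of n i f A \<Theta> \<tau>] f by (simp add: space)
  have "(\<lambda>\<tau>. \<tau>) \<in> borel_measurable (type_lborel (others n i) D \<Theta>)"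
  proof (rule borel_measurable_profile)
    fix j assume "j \<in> others n i"
    then show "(\<lambda>\<tau>. \<tau> j) \<in> borel_measurable (type_lborel (others n i) D \<Theta>)"
      using measurable_type_lborel_component[of j "others n i" D \<Theta>]
      by (simp add: measurable_restrict_space2_iff)
  qed (simp add: space_type_lborel PiE_def)
  then have "?h \<in> borel_measurable P"
    unfolding measurable_cong_sets[OF P refl]
    by (intro borel_measurable_Pair play_borel_measurable[where A = A]) (auto intro: f)
  \<comment> \<open>The loss is continuous only on \<open>?T\<close>, so the inner map has to land
    in the restricted space before composing.\<close>
  then have "?h \<in> measurable P (restrict_space borel ?T)"
    using h by (intro measurable_restrict_space2) auto
  then have "(\<lambda>\<tau>. ?c (?h \<tau>)) \<in> borel_measurable P"
    using borel_measurable_continuous_on_restrict[OF loss_continuous[OF i]]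
    by (rule measurable_compose)
  moreover have "bounded ((\<lambda>\<tau>. ?c (?h \<tau>)) ` space P)"
  proof -
    have "compact ?T"
      using i action_spaces type_spaces
      by (intro compact_Times compact_PiE) (auto simp: others_def)
    then have bounded: "bounded (?c ` ?T)"
      by (intro compact_imp_bounded compact_continuous_image[OF loss_continuous[OF i]])
    have "?h ` space P \<subseteq> ?T" using h by (rule image_subsetI)
    then have "?c ` ?h ` space P \<subseteq> ?c ` ?T" by (rule image_mono)
    then show ?thesis using bounded_subset[OF bounded] by (simp only: image_image)
  qed
  ultimately show ?thesis by (simp add: random_losses_def)
qed

section \<open>Effect on a player of a change in the opponents' strategies\<close>

text \<open>\<open>G\<close> is vector valued so that one estimate serves both the loss and its
  gradient; the pointwise Lipschitz bound is uniform in the opponents' types.\<close>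

lemma SUP_play_dist_le:
  fixes G :: "(nat \<Rightarrow> 'a::real_normed_vector) \<Rightarrow> (nat \<Rightarrow> 'b) \<Rightarrow> 'c::real_normed_vector"
  assumes lip: "\<And>b b' \<tau>. b \<in> Pi\<^sub>E (others n i) A \<Longrightarrow> b' \<in> Pi\<^sub>E (others n i) A \<Longrightarrow>
      \<tau> \<in> Pi\<^sub>E (others n i) \<Theta> \<Longrightarrow> norm (G b' \<tau> - G b \<tau>) \<le> (\<Sum>j\<in>others n i. L j * norm (b' j - b j))"
    and L: "\<And>j. j \<in> others n i \<Longrightarrow> 0 \<le> L j"
    and f: "\<And>j \<theta>. j \<in> others n i \<Longrightarrow> \<theta> \<in> \<Theta> j \<Longrightarrow> f j \<theta> \<in> A j"
    and f': "\<And>j \<theta>. j \<in> others n i \<Longrightarrow> \<theta> \<in> \<Theta> j \<Longrightarrow> f' j \<theta> \<in> A j"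
    and d: "\<And>j \<theta>. j \<in> others n i \<Longrightarrow> \<theta> \<in> \<Theta> j \<Longrightarrow> norm (f j \<theta> - f' j \<theta>) \<le> d j"
    and \<Theta>: "\<And>j. j \<in> others n i \<Longrightarrow> \<Theta> j \<noteq> {}"
  shows "(SUP \<tau>\<in>Pi\<^sub>E (others n i) \<Theta>. norm (G (play n i f \<tau>) \<tau> - G (play n i f' \<tau>) \<tau>))
    \<le> (\<Sum>j\<in>others n i. L j * d j)"
proof (rule cSUP_least)
  \<comment> \<open>This includes \<open>n = 1\<close>: the product over no opponents is a
    singleton.\<close>
  show "Pi\<^sub>E (others n i) \<Theta> \<noteq> {}" using \<Theta> by (simp add: PiE_eq_empty_iff)
  fix \<tau> assume \<tau>: "\<tau> \<in> Pi\<^sub>E (others n i) \<Theta>"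
  have "norm (G (play n i f \<tau>) \<tau> - G (play n i f' \<tau>) \<tau>)
      \<le> (\<Sum>j\<in>others n i. L j * norm (play n i f \<tau> j - play n i f' \<tau> j))"
    using \<tau> by (intro lip) (auto simp: play_def intro!: f f' PiE_mem[OF \<tau>])
  also have "\<dots> \<le> (\<Sum>j\<in>others n i. L j * d j)"
    using \<tau> L d by (intro sum_mono mult_left_mono) (auto simp: play_def)
  finally show "norm (G (play n i f \<tau>) \<tau> - G (play n i f' \<tau>) \<tau>) \<le> (\<Sum>j\<in>others n i. L j * d j)" .
qed

text \<open>Bridges equilibria, which are profiles of all players, and the gradient hypotheses,
  which quantify over opponents' profiles.\<close>

lemma play_restrict [simp]: "play n i (restrict f (others n i)) = play n i f"
  by (auto simp: play_def fun_eq_iff)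

section \<open>Coupling of the best responses through the interaction matrix\<close>

theorem theorem5p4:
  fixes n t :: nat
    and E A :: "nat \<Rightarrow> 'a::euclidean_space set"
    and D \<Theta> :: "nat \<Rightarrow> 'b::euclidean_space set"
    and c :: "nat \<Rightarrow> 'a \<Rightarrow> (nat \<Rightarrow> 'a) \<Rightarrow> 'b \<Rightarrow> (nat \<Rightarrow> 'b) \<Rightarrow> real"
    and dz :: "'z measure"
    and p :: "'z \<Rightarrow> (nat \<Rightarrow> 'b) \<Rightarrow> real"
    and m :: "nat \<Rightarrow> nat \<Rightarrow> 'z \<Rightarrow> real"
    and \<rho> :: "nat \<Rightarrow> (nat \<Rightarrow> 'b) measure \<Rightarrow> ((nat \<Rightarrow> 'b) \<Rightarrow> real) \<Rightarrow> real"
    and \<nu> :: "nat \<Rightarrow> 'b \<Rightarrow> (nat \<Rightarrow> 'b) measure"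
    and M \<kappa>0 \<kappa>1 :: "nat \<Rightarrow> real"
    and L0 L1 :: "nat \<Rightarrow> nat \<Rightarrow> real"
    and grad_c :: "nat \<Rightarrow> 'a \<Rightarrow> (nat \<Rightarrow> 'a) \<Rightarrow> 'b \<Rightarrow> (nat \<Rightarrow> 'b) \<Rightarrow> 'a"
    and grad_\<rho> :: "nat \<Rightarrow> 'a \<Rightarrow> (nat \<Rightarrow> 'b \<Rightarrow> 'a) \<Rightarrow> 'b \<Rightarrow> 'a"
  defines "\<nu> \<equiv> \<lambda>i. cond_pred n D \<Theta> dz p (m t i) i"
  assumes game: "bayesian_game n E D A \<Theta> c"
    and beliefs: "belief_model n D \<Theta> dz p m"
    and risk: "\<forall>i\<in>{1..n}. \<forall>\<theta>\<in>\<Theta> i. risk_measure (\<nu> i \<theta>) (\<rho> i (\<nu> i \<theta>))"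
    and risk_convex: "\<forall>i\<in>{1..n}. \<forall>\<theta>\<in>\<Theta> i. convex_functional (\<nu> i \<theta>) (\<rho> i (\<nu> i \<theta>))"
    and strong_convexity: "\<forall>i\<in>{1..n}. 0 < M i \<and>
      (\<forall>b\<in>Pi\<^sub>E (others n i) A. \<forall>\<theta>\<in>\<Theta> i. \<forall>\<tau>\<in>Pi\<^sub>E (others n i) \<Theta>.
         strongly_convex_on (M i) (A i) (\<lambda>a. c i a b \<theta> \<tau>))"
    and loss_gradient: "\<forall>i\<in>{1..n}. \<forall>b\<in>Pi\<^sub>E (others n i) A. \<forall>\<theta>\<in>\<Theta> i. \<forall>\<tau>\<in>Pi\<^sub>E (others n i) \<Theta>.
      \<forall>a\<in>A i. has_gradient_on (\<lambda>x. c i x b \<theta> \<tau>) (grad_c i a b \<theta> \<tau>) (span (E i)) (A i) a"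
    and L_nonneg: "\<forall>i\<in>{1..n}. \<forall>j\<in>others n i. 0 \<le> L0 i j \<and> 0 \<le> L1 i j"
    and loss_Lipschitz: "\<forall>i\<in>{1..n}. \<forall>b\<in>Pi\<^sub>E (others n i) A. \<forall>b'\<in>Pi\<^sub>E (others n i) A.
      \<forall>a\<in>A i. \<forall>\<theta>\<in>\<Theta> i. \<forall>\<tau>\<in>Pi\<^sub>E (others n i) \<Theta>.
        \<bar>c i a b' \<theta> \<tau> - c i a b \<theta> \<tau>\<bar> \<le> (\<Sum>j\<in>others n i. L0 i j * norm (b' j - b j))"
    and gradient_Lipschitz: "\<forall>i\<in>{1..n}. \<forall>b\<in>Pi\<^sub>E (others n i) A. \<forall>b'\<in>Pi\<^sub>E (others n i) A.
      \<forall>a\<in>A i. \<forall>\<theta>\<in>\<Theta> i. \<forall>\<tau>\<in>Pi\<^sub>E (others n i) \<Theta>.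
        norm (grad_c i a b' \<theta> \<tau> - grad_c i a b \<theta> \<tau>)
          \<le> (\<Sum>j\<in>others n i. L1 i j * norm (b' j - b j))"
    and kappa_nonneg: "\<forall>i\<in>{1..n}. 0 \<le> \<kappa>0 i \<and> 0 \<le> \<kappa>1 i"
    and risk_gradient: "\<forall>i\<in>{1..n}. \<forall>f\<in>Pi\<^sub>E (others n i) (strategies A \<Theta>). \<forall>\<theta>\<in>\<Theta> i. \<forall>a\<in>A i.
      has_gradient_on (\<lambda>x. \<rho> i (\<nu> i \<theta>) (\<lambda>\<tau>. c i x (play n i f \<tau>) \<theta> \<tau>))
        (grad_\<rho> i a f \<theta>) (span (E i)) (A i) a"
    and risk_gradient_Lipschitz: "\<forall>i\<in>{1..n}. \<forall>f\<in>Pi\<^sub>E (others n i) (strategies A \<Theta>).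
      \<forall>f'\<in>Pi\<^sub>E (others n i) (strategies A \<Theta>). \<forall>\<theta>\<in>\<Theta> i. \<forall>a\<in>A i.
        norm (grad_\<rho> i a f \<theta> - grad_\<rho> i a f' \<theta>) \<le>
          \<kappa>1 i * (SUP \<tau>\<in>Pi\<^sub>E (others n i) \<Theta>.
            norm (grad_c i a (play n i f \<tau>) \<theta> \<tau> - grad_c i a (play n i f' \<tau>) \<theta> \<tau>)) +
          \<kappa>0 i * (SUP \<tau>\<in>Pi\<^sub>E (others n i) \<Theta>.
            \<bar>c i a (play n i f \<tau>) \<theta> \<tau> - c i a (play n i f' \<tau>) \<theta> \<tau>\<bar>)"
    and spectral: "spectral_radius (Gamma_bp n (K_bp \<kappa>0 \<kappa>1 L0 L1) M) < 1"
  shows "\<exists>\<^sub>\<le>\<^sub>1 f. bne_bpd n A \<Theta> c \<rho> \<nu> f"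
proof (rule Uniq_I)
  fix f f' assume f: "bne_bpd n A \<Theta> c \<rho> \<nu> f" and f': "bne_bpd n A \<Theta> c \<rho> \<nu> f'"
  interpret bayesian_game n E D A \<Theta> c by (rule game)
  define K where "K = K_bp \<kappa>0 \<kappa>1 L0 L1"
  define d where "d j = (SUP \<theta>\<in>\<Theta> j. norm (f j \<theta> - f' j \<theta>))" for j
  have strat: "f j \<in> strategies A \<Theta> j" "f' j \<in> strategies A \<Theta> j" if "j \<in> {1..n}" for j
    using f f' that unfolding bne_bpd_def by blast+
  have mem: "f j \<theta> \<in> A j" "f' j \<theta> \<in> A j" if "j \<in> {1..n}" "\<theta> \<in> \<Theta> j" for j \<theta>
    by (rule strategies_mem[OF strat(1)[OF that(1)] that(2)],
        rule strategies_mem[OF strat(2)[OF that(1)] that(2)])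
  have others: "j \<in> {1..n}" if "j \<in> others n i" for i j using that by (simp add: others_def)
  have norm_le_d: "norm (f j \<theta> - f' j \<theta>) \<le> d j" if j: "j \<in> {1..n}" and \<theta>: "\<theta> \<in> \<Theta> j" for j \<theta>
    unfolding d_def
  \<comment> \<open>A real supremum dominates its members only for a bounded family; compact action
    sets provide the bound.\<close>
  proof (rule cSUP_upper[OF \<theta>])
    have "bounded (A j)" using action_spaces[OF j] compact_imp_bounded by blast
    then obtain B where B: "\<And>a. a \<in> A j \<Longrightarrow> norm a \<le> B" by (auto simp: bounded_iff)
    have "norm (f j \<theta> - f' j \<theta>) \<le> B + B" if "\<theta> \<in> \<Theta> j" for \<theta>
      using B[OF mem(1)[OF j that]] B[OF mem(2)[OF j that]] norm_triangle_ineq4[of "f j \<theta>" "f' j \<theta>"]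
      by linarith
    then show "bdd_above ((\<lambda>\<theta>. norm (f j \<theta> - f' j \<theta>)) ` \<Theta> j)" by (rule bdd_aboveI2)
  qed
  have d_nonneg: "0 \<le> d j" if j: "j \<in> {1..n}" for j
  proof -
    obtain \<theta> where "\<theta> \<in> \<Theta> j" using type_spaces[OF j] by blast
    from order_trans[OF norm_ge_zero norm_le_d[OF j this]] show ?thesis .
  qed
  \<comment> \<open>Both objectives are differentiated at \<open>f' i \<theta>\<close>, the
    minimiser against \<open>f'\<close>; the strongly convex objective is the one against
    \<open>f\<close>.\<close>
  have best_response: "M i * norm (f i \<theta> - f' i \<theta>) \<le> (\<Sum>j\<in>others n i. K i j * d j)"
    if i: "i \<in> {1..n}" and \<theta>: "\<theta> \<in> \<Theta> i" for i \<theta>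
  proof -
    let ?r = "\<lambda>f. restrict f (others n i)"
    let ?loss = "\<lambda>f a. \<rho> i (\<nu> i \<theta>) (\<lambda>\<tau>. c i a (play n i f \<tau>) \<theta> \<tau>)"
    \<comment> \<open>Holds at every type, even where the marginal density vanishes and the quotient
      defaults to 0: a density keeps the sigma-algebra of its base measure.\<close>
    have sets: "sets (\<nu> i \<theta>) = sets (type_lborel (others n i) D \<Theta>)"
      by (simp add: \<nu>_def cond_pred_def)
    then have space: "space (\<nu> i \<theta>) = Pi\<^sub>E (others n i) \<Theta>"
      by (rule sets_eq_imp_space_eq[THEN trans]) (rule space_type_lborel)
    have restr: "?r f \<in> Pi\<^sub>E (others n i) (strategies A \<Theta>)" "?r f' \<in> Pi\<^sub>E (others n i) (strategies A \<Theta>)"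
      using strat others by auto
    have A: "convex (A i)" using action_spaces[OF i] by simp
    have a: "f' i \<theta> \<in> A i" using mem i \<theta> by simp
    have \<Theta>_ne: "\<Theta> j \<noteq> {}" if "j \<in> others n i" for j
      using type_spaces[OF others[OF that]] by simp
    have "strongly_convex_on (M i) (A i) (?loss f)"
    proof (rule strongly_convex_on_risk[where P = "\<nu> i \<theta>" and \<rho> = "\<rho> i (\<nu> i \<theta>)" and
          \<xi> = "\<lambda>a \<tau>. c i a (play n i f \<tau>) \<theta> \<tau>", OF _ _ A])
      show "risk_measure (\<nu> i \<theta>) (\<rho> i (\<nu> i \<theta>))" "convex_functional (\<nu> i \<theta>) (\<rho> i (\<nu> i \<theta>))"
        using risk risk_convex i \<theta> by auto
      show "(\<lambda>\<tau>. c i a (play n i f \<tau>) \<theta> \<tau>) \<in> random_losses (\<nu> i \<theta>)" if "a \<in> A i" for a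
        using strat(1) others by (intro loss_random[OF i _ that \<theta> sets]) blast
      show "strongly_convex_on (M i) (A i) (\<lambda>a. c i a (play n i f \<tau>) \<theta> \<tau>)"
        if "\<tau> \<in> space (\<nu> i \<theta>)" for \<tau>
      proof -
        have \<tau>: "\<tau> \<in> Pi\<^sub>E (others n i) \<Theta>" using that unfolding space .
        have "play n i f \<tau> \<in> Pi\<^sub>E (others n i) A"
          by (rule play_mem[OF _ \<tau>]) (use strat(1) others in blast)
        then show ?thesis using strong_convexity i \<theta> \<tau> by blast
      qed
    qed
    moreover have "is_arg_min (?loss f) (\<lambda>a. a \<in> A i) (f i \<theta>)"
      "is_arg_min (?loss f') (\<lambda>a. a \<in> A i) (f' i \<theta>)"
      using f f' i \<theta> unfolding bne_bpd_def by blast+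
    moreover have
      "(?loss f has_derivative (\<lambda>h. inner (grad_\<rho> i (f' i \<theta>) (?r f) \<theta>) h)) (at (f' i \<theta>) within A i)"
      "(?loss f' has_derivative (\<lambda>h. inner (grad_\<rho> i (f' i \<theta>) (?r f') \<theta>) h)) (at (f' i \<theta>) within A i)"
      using risk_gradient[rule_format, OF i restr(1) \<theta> a] risk_gradient[rule_format, OF i restr(2) \<theta> a]
      by (simp_all add: has_gradient_on_def)
    ultimately have "M i * norm (f i \<theta> - f' i \<theta>)
        \<le> norm (grad_\<rho> i (f' i \<theta>) (?r f) \<theta> - grad_\<rho> i (f' i \<theta>) (?r f') \<theta>)"
      by (rule arg_min_dist_le_gradient_dist[OF _ A])
    \<comment> \<open>The absolute value is written as \<open>norm\<close> to make both suprema
      instances of the same lemma.\<close>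
    also have "\<dots> \<le> \<kappa>1 i * (SUP \<tau>\<in>Pi\<^sub>E (others n i) \<Theta>.
          norm (grad_c i (f' i \<theta>) (play n i f \<tau>) \<theta> \<tau> - grad_c i (f' i \<theta>) (play n i f' \<tau>) \<theta> \<tau>)) +
        \<kappa>0 i * (SUP \<tau>\<in>Pi\<^sub>E (others n i) \<Theta>.
          norm (c i (f' i \<theta>) (play n i f \<tau>) \<theta> \<tau> - c i (f' i \<theta>) (play n i f' \<tau>) \<theta> \<tau>))"
      using risk_gradient_Lipschitz[rule_format, OF i restr \<theta> a] by simp
    also have "\<dots> \<le> \<kappa>1 i * (\<Sum>j\<in>others n i. L1 i j * d j) + \<kappa>0 i * (\<Sum>j\<in>others n i. L0 i j * d j)"
    proof (intro add_mono mult_left_mono)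
      show "(SUP \<tau>\<in>Pi\<^sub>E (others n i) \<Theta>.
          norm (grad_c i (f' i \<theta>) (play n i f \<tau>) \<theta> \<tau> - grad_c i (f' i \<theta>) (play n i f' \<tau>) \<theta> \<tau>))
          \<le> (\<Sum>j\<in>others n i. L1 i j * d j)"
      proof (rule SUP_play_dist_le[where A = A and G = "\<lambda>b \<tau>. grad_c i (f' i \<theta>) b \<theta> \<tau>"])
        show "norm (grad_c i (f' i \<theta>) b' \<theta> \<tau> - grad_c i (f' i \<theta>) b \<theta> \<tau>)
            \<le> (\<Sum>j\<in>others n i. L1 i j * norm (b' j - b j))"
          if "b \<in> Pi\<^sub>E (others n i) A" "b' \<in> Pi\<^sub>E (others n i) A" "\<tau> \<in> Pi\<^sub>E (others n i) \<Theta>" for b b' \<tau>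
          using gradient_Lipschitz[rule_format, OF i that(1,2) a \<theta> that(3)] by simp
      qed (use L_nonneg i others mem norm_le_d \<Theta>_ne in blast)+
      show "(SUP \<tau>\<in>Pi\<^sub>E (others n i) \<Theta>.
          norm (c i (f' i \<theta>) (play n i f \<tau>) \<theta> \<tau> - c i (f' i \<theta>) (play n i f' \<tau>) \<theta> \<tau>))
          \<le> (\<Sum>j\<in>others n i. L0 i j * d j)"
      proof (rule SUP_play_dist_le[where A = A and G = "\<lambda>b \<tau>. c i (f' i \<theta>) b \<theta> \<tau>"])
        show "norm (c i (f' i \<theta>) b' \<theta> \<tau> - c i (f' i \<theta>) b \<theta> \<tau>)
            \<le> (\<Sum>j\<in>others n i. L0 i j * norm (b' j - b j))"
          if "b \<in> Pi\<^sub>E (others n i) A" "b' \<in> Pi\<^sub>E (others n i) A" "\<tau> \<in> Pi\<^sub>E (others n i) \<Theta>" for b b' \<tau>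
          using loss_Lipschitz[rule_format, OF i that(1,2) a \<theta> that(3)] by simp
      qed (use L_nonneg i others mem norm_le_d \<Theta>_ne in blast)+
    qed (use kappa_nonneg i in auto)
    also have "\<dots> = (\<Sum>j\<in>others n i. K i j * d j)"
      unfolding sum_distrib_left sum.distrib[symmetric]
      by (intro sum.cong refl) (simp add: K_def K_bp_def others_def algebra_simps)
    finally show ?thesis .
  qed
  have M: "0 < M i" if "i \<in> {1..n}" for i using strong_convexity that by blast
  \<comment> \<open>The bound on the distance at one type does not mention that type, so it passes
    to the supremum.\<close>
  have d_le: "d i \<le> (\<Sum>j\<in>{1..n}. K i j / M i * d j)" if i: "i \<in> {1..n}" for i
    unfolding d_def[of i]
  proof (rule cSUP_least)
    fix \<theta> assume "\<theta> \<in> \<Theta> i"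
    then have "norm (f i \<theta> - f' i \<theta>) \<le> (\<Sum>j\<in>others n i. K i j * d j) / M i"
      using best_response[OF i] M[OF i] by (simp add: field_simps)
    \<comment> \<open>The added diagonal term is zero because \<open>K i i = 0\<close>.\<close>
    also have "\<dots> = (\<Sum>j\<in>{1..n}. K i j / M i * d j)"
      unfolding sum_divide_distrib others_def
      by (intro sum.mono_neutral_cong_left) (auto simp: K_def K_bp_def)
    finally show "norm (f i \<theta> - f' i \<theta>) \<le> (\<Sum>j\<in>{1..n}. K i j / M i * d j)" .
  qed (use type_spaces[OF i] in simp)
  \<comment> \<open>Matrix row \<open>r\<close> belongs to player \<open>Suc r\<close>, hence the
    shifted indices.\<close>
  have d_zero: "d (Suc r) = 0" if r: "r < n" for r
  proof (rule subinvariant_imp_zero[where G = "\<lambda>r u. K (Suc r) (Suc u) / M (Suc r)"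
        and x = "\<lambda>r. d (Suc r)", OF _ _ _ _ r])
    show "0 \<le> K (Suc r) (Suc u) / M (Suc r)" if "r < n" "u < n" for r u
      using that L_nonneg kappa_nonneg M[of "Suc r"] by (auto simp: K_def K_bp_def others_def)
    show "spectral_radius (Matrix.mat n n (\<lambda>(r, u). complex_of_real (K (Suc r) (Suc u) / M (Suc r)))) < 1"
      using spectral by (simp add: Gamma_bp_def K_def)
    show "0 \<le> d (Suc r)" if "r < n" for r using that by (intro d_nonneg) simp
    show "d (Suc r) \<le> (\<Sum>u<n. K (Suc r) (Suc u) / M (Suc r) * d (Suc u))" if "r < n" for r
      using d_le[of "Suc r"] that by (simp add: sum.atLeast1_atMost_eq)
  qed
  show "f = f'"
  proof (rule PiE_ext)
    show "f \<in> Pi\<^sub>E {1..n} (strategies A \<Theta>)" "f' \<in> Pi\<^sub>E {1..n} (strategies A \<Theta>)"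
      using f f' unfolding bne_bpd_def by blast+
    fix i assume i: "i \<in> {1..n}"
    show "f i = f' i"
    \<comment> \<open>Distance zero forces agreement on \<open>\<Theta> i\<close>; elsewhere both
      strategies are \<open>undefined\<close>.\<close>
    proof (rule extensionalityI)
      show "f i \<in> extensional (\<Theta> i)" "f' i \<in> extensional (\<Theta> i)"
        using strat[OF i] by (auto simp: strategies_def)
      fix \<theta> assume \<theta>: "\<theta> \<in> \<Theta> i"
      obtain r where "i = Suc r" "r < n" using i by (cases i) auto
      then have "d i = 0" using d_zero by simp
      then show "f i \<theta> = f' i \<theta>" using norm_le_d[OF i \<theta>] by simp
    qed
  qed
qed

end
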